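(* Let $F$ be a forest on $n$ vertices (of arbitrary maximum degree) and let $\mathcal{U}$ be any UFO tree for $F$. Then $\mathcal{U}$ has height $O(\log n)$, contains $O(n)$ nodes (clusters) in total, and uses $O(n)$ space.
   Context: UFO trees. Let $F$ be a forest with vertex set $V$, $|V|=n$. A cluster is a vertex set inducing a connected subgraph of $F$. Level-$0$ clusters are the singletons $\{v\}$. The level-$i$ clusters partition $V$; two level-$i$ clusters are adjacent if an edge of $F$ joins them, and the degree of a cluster is the number of edges of $F$ with exactly one endpoint in it; a cluster is high degree if its degree is at least $3$. Level $i+1$ is obtained from level $i$ by choosing pairwise disjoint groups of level-$i$ clusters, each being an allowed merge: two adjacent clusters of degrees $\{1,1\}$, $\{1,2\}$ or $\{2,2\}$, or a high-degree cluster together with one or more adjacent degree-$1$ clusters. The choice must be maximal in the following sense: every high-degree cluster is grouped together with all of its adjacent degree-$1$ clusters, and among the remaining clusters of degree $1$ and $2$ the pairs form a maximal matching of allowed pairs (no two adjacent ungrouped clusters form an allowed pair). Each group is replaced by its union; each ungrouped cluster becomes a level-$(i+1)$ cluster by itself. This is repeated until every component of $F$ is one cluster. The UFO tree is the rooted forest of all clusters of all levels, the parent of a level-$i$ cluster being the level-$(i+1)$ cluster containing it; its height is the number of levels above level $0$. The space counts, for each cluster, its parent and children pointers and its adjacency list at its level.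
   Formalization: A cluster that is already a whole component of F is a root and is not copied to later levels; if it were, isolated vertices beside a long path would give order n log n nodes, so the O(n) claims would fail. Vertices are taken to be natural numbers. *)

theory Defs
  imports Main "HOL-Library.Log_Nat"
begin

definition graph :: "nat set \<Rightarrow> nat set set \<Rightarrow> bool" where
  "graph V E \<longleftrightarrow> finite V \<and> (\<forall>e\<in>E. \<exists>u v. e = {u, v} \<and> u \<noteq> v \<and> u \<in> V \<and> v \<in> V)"

definition is_cycle :: "nat set set \<Rightarrow> nat list \<Rightarrow> bool" where
  "is_cycle E vs \<longleftrightarrow> length vs \<ge> 3 \<and> distinct vs \<and>
     (\<forall>i. Suc i < length vs \<longrightarrow> {vs ! i, vs ! Suc i} \<in> E) \<and> {last vs, hd vs} \<in> E"

definition forest :: "nat set \<Rightarrow> nat set set \<Rightarrow> bool" where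
  "forest V E \<longleftrightarrow> graph V E \<and> \<not> (\<exists>vs. is_cycle E vs)"

definition edge_rel :: "nat set set \<Rightarrow> (nat \<times> nat) set" where
  "edge_rel E = {(x, y). {x, y} \<in> E}"

definition comps :: "nat set \<Rightarrow> nat set set \<Rightarrow> nat set set" where
  "comps V E = V // ({(u, v). u \<in> V \<and> v \<in> V \<and> (u, v) \<in> (edge_rel E)\<^sup>*})"

definition cdeg :: "nat set set \<Rightarrow> nat set \<Rightarrow> nat" where
  "cdeg E C = card {e \<in> E. card (e \<inter> C) = 1}"

definition cadj :: "nat set set \<Rightarrow> nat set \<Rightarrow> nat set \<Rightarrow> bool" where
  "cadj E C D \<longleftrightarrow> C \<noteq> D \<and> (\<exists>e\<in>E. e \<inter> C \<noteq> {} \<and> e \<inter> D \<noteq> {})"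

definition allowed_group :: "nat set set \<Rightarrow> nat set set \<Rightarrow> nat set set \<Rightarrow> bool" where
  "allowed_group E P G \<longleftrightarrow> G \<subseteq> P \<and>
     ((\<exists>C D. G = {C, D} \<and> cadj E C D \<and> cdeg E C \<in> {1, 2} \<and> cdeg E D \<in> {1, 2}) \<or>
      (\<exists>H\<in>G. cdeg E H \<ge> 3 \<and> G - {H} \<noteq> {} \<and>
          (\<forall>D\<in>G - {H}. cdeg E D = 1 \<and> cadj E H D)))"

definition ufo_step :: "nat set set \<Rightarrow> nat set set \<Rightarrow> nat set set set \<Rightarrow> nat set set \<Rightarrow> bool" where
  "ufo_step E P Gs P' \<longleftrightarrow>
     (\<forall>G\<in>Gs. allowed_group E P G) \<and>
     (\<forall>G1\<in>Gs. \<forall>G2\<in>Gs. G1 \<noteq> G2 \<longrightarrow> G1 \<inter> G2 = {}) \<and>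
     \<comment> \<open>every high-degree cluster is grouped with all its adjacent degree-1 clusters\<close>
     (\<forall>H\<in>P. \<forall>D\<in>P. cdeg E H \<ge> 3 \<longrightarrow> cdeg E D = 1 \<longrightarrow> cadj E H D \<longrightarrow>
         (\<exists>G\<in>Gs. H \<in> G \<and> D \<in> G)) \<and>
     \<comment> \<open>maximality of the matching among the remaining degree-1/2 clusters\<close>
     (\<forall>C\<in>P. \<forall>D\<in>P. cadj E C D \<longrightarrow> cdeg E C \<in> {1, 2} \<longrightarrow> cdeg E D \<in> {1, 2} \<longrightarrow>
         (\<exists>G\<in>Gs. C \<in> G) \<or> (\<exists>G\<in>Gs. D \<in> G)) \<and>
     P' = (Union ` Gs) \<union> (P - \<Union>Gs)"

definition is_ufo :: "nat set \<Rightarrow> nat set set \<Rightarrow> (nat \<Rightarrow> nat set set) \<Rightarrow> nat \<Rightarrow> bool" where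
  "is_ufo V E P h \<longleftrightarrow> forest V E \<and>
     P 0 = (\<lambda>v. {v}) ` V \<and>
     (\<forall>i<h. \<exists>Gs. ufo_step E (P i) Gs (P (Suc i))) \<and>
     P h = comps V E \<and> (\<forall>i<h. P i \<noteq> comps V E)"

text \<open>Nodes of the UFO tree: pairs (level, cluster). A cluster that already is a whole
  component at level i-1 is a root and is not replicated at level i.\<close>
definition ufo_nodes :: "nat set \<Rightarrow> nat set set \<Rightarrow> (nat \<Rightarrow> nat set set) \<Rightarrow> nat \<Rightarrow> (nat \<times> nat set) set" where
  "ufo_nodes V E P h = {(i, C). i \<le> h \<and> C \<in> P i \<and>
       (i = 0 \<or> C \<notin> P (i - 1) \<or> C \<notin> comps V E)}"

definition ufo_children :: "nat set \<Rightarrow> nat set set \<Rightarrow> (nat \<Rightarrow> nat set set) \<Rightarrow> nat \<Rightarrow> nat \<times> nat set \<Rightarrow> (nat \<times> nat set) set" where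
  "ufo_children V E P h x = {(j, D) \<in> ufo_nodes V E P h. Suc j = fst x \<and> D \<subseteq> snd x}"

text \<open>Space: per node one parent pointer, its children pointers and its adjacency list at its level.\<close>
definition ufo_space :: "nat set \<Rightarrow> nat set set \<Rightarrow> (nat \<Rightarrow> nat set set) \<Rightarrow> nat \<Rightarrow> nat" where
  "ufo_space V E P h = (\<Sum>x\<in>ufo_nodes V E P h.
       1 + card (ufo_children V E P h x) + card {D \<in> P (fst x). cadj E (snd x) D})"

end

theory Submission
  imports Defs "HOL-Library.Disjoint_Sets"
begin

text \<open>
  Let m be the number of clusters of positive degree at some level. Adding the edges between clusters
  to those inside clusters loses one component per edge of the forest, so at most m edges
  run between clusters and the degrees sum to at most 2m. Hence there are no more high-degree
  clusters than leaves, and their degrees sum to at most three times the number of leaves. By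
  maximality, an ungrouped cluster of degree 1 or 2 is next to a grouped one, or it has
  degree 2 and is next to a high-degree one; so the grouped clusters of degree 1 or 2 are at
  least m/15 of all. Merging a group removes at least half as many clusters as it has members of
  degree 1 or 2, so m drops by a factor 29/30 per level. The level sizes form a
  geometric series and the last level is reached after logarithmically many steps.
\<close>

subsection \<open>Components of a forest\<close>

lemma graph_edgeE:
  assumes "graph V E" "e \<in> E"
  obtains u v where "e = {u, v}" "u \<noteq> v" "u \<in> V" "v \<in> V"
  using assms unfolding graph_def by blast

lemma graph_finite_edges:
  assumes "graph V E"
  shows "finite E"
proof -
  have "E \<subseteq> Pow V" using graph_edgeE[OF assms] by blast
  then show ?thesis using assms finite_subset unfolding graph_def by blast
qed

lemma sym_edge_rel: "sym (edge_rel E)"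
  by (auto simp: sym_def edge_rel_def insert_commute)

lemma edge_rel_mono: "E \<subseteq> F \<Longrightarrow> (edge_rel E)\<^sup>* \<subseteq> (edge_rel F)\<^sup>*"
  by (rule rtrancl_mono) (auto simp: edge_rel_def)

lemma edge_rel_rtrancl_sym: "(u, v) \<in> (edge_rel E)\<^sup>* \<Longrightarrow> (v, u) \<in> (edge_rel E)\<^sup>*"
  using sym_rtrancl[OF sym_edge_rel] by (rule symD)

section \<open>Counting components as classes of the reachability relation\<close>

definition conn :: "nat set \<Rightarrow> nat set set \<Rightarrow> (nat \<times> nat) set" where
  "conn V E = {(u, v). u \<in> V \<and> v \<in> V \<and> (u, v) \<in> (edge_rel E)\<^sup>*}"

lemma comps_conn: "comps V E = V // conn V E"
  by (simp add: comps_def conn_def)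

lemma equiv_conn: "equiv V (conn V E)"
proof (rule equivI)
  show "conn V E \<subseteq> V \<times> V" by (auto simp: conn_def)
  show "refl_on V (conn V E)" by (auto simp: refl_on_def conn_def)
  show "sym (conn V E)" by (auto simp: sym_def conn_def intro: edge_rel_rtrancl_sym)
  show "trans (conn V E)" by (auto simp: trans_def conn_def intro: rtrancl_trans)
qed

text \<open>Enlarging the edge set only merges classes, so taking the image under the coarser
  relation sends the component of \<open>v\<close> in \<open>F\<close> to its component in
  \<open>F'\<close>. This is the map by which components are compared below.\<close>

lemma conn_class_image:
  assumes "F \<subseteq> F'" "v \<in> V"
  shows "conn V F' `` (conn V F `` {v}) = conn V F' `` {v}"
  using assms edge_rel_mono[OF assms(1)]
  by (auto simp: conn_def intro: rtrancl_trans)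

text \<open>Turns reachability into the list format of \<open>is_cycle\<close>. The path grows edge
  by edge; when the new vertex already occurs on it, the path is cut back to that
  occurrence.\<close>

lemma rtrancl_distinct_path:
  assumes "(u, v) \<in> (edge_rel F)\<^sup>*"
  shows "\<exists>vs. vs \<noteq> [] \<and> distinct vs \<and> hd vs = u \<and> last vs = v \<and>
           (\<forall>i. Suc i < length vs \<longrightarrow> {vs ! i, vs ! Suc i} \<in> F)"
  using assms
proof (induction rule: rtrancl_induct)
  case base
  show ?case by (rule exI[of _ "[u]"]) auto
next
  case (step y z)
  then obtain vs where vs: "vs \<noteq> []" "distinct vs" "hd vs = u" "last vs = y"
    "\<And>i. Suc i < length vs \<Longrightarrow> {vs ! i, vs ! Suc i} \<in> F" by blast
  have yz: "{y, z} \<in> F" using step(2) by (simp add: edge_rel_def)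
  show ?case
  proof (cases "z \<in> set vs")
    case True
    then obtain xs ys where eq: "vs = xs @ z # ys" by (meson split_list)
    have "{(xs @ [z]) ! i, (xs @ [z]) ! Suc i} \<in> F" if "Suc i < length (xs @ [z])" for i
    proof -
      have "vs = (xs @ [z]) @ ys" using eq by simp
      then have "(xs @ [z]) ! i = vs ! i" "(xs @ [z]) ! Suc i = vs ! Suc i"
        using that by (metis nth_append Suc_lessD)+
      then show ?thesis using vs(5)[of i] that eq by simp
    qed
    then show ?thesis using vs eq
      by (intro exI[of _ "xs @ [z]"]) (auto simp: hd_append)
  next
    case False
    have "{(vs @ [z]) ! i, (vs @ [z]) ! Suc i} \<in> F" if i: "Suc i < length (vs @ [z])" for i
    proof (cases "Suc i < length vs")
      case True
      then show ?thesis using vs(5)[of i] by (simp add: nth_append)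
    next
      case False
      then have "i = length vs - 1" "Suc i = length vs" using i by auto
      then show ?thesis using yz vs(1,4) by (simp add: nth_append last_conv_nth)
    qed
    then show ?thesis using vs False by (intro exI[of _ "vs @ [z]"]) auto
  qed
qed

text \<open>A simple path from \<open>u\<close> to \<open>v\<close> inside \<open>F\<close> would be
  closed by the edge \<open>{u, v}\<close> to a cycle of \<open>E\<close>. Length 1 is excluded by
  \<open>u \<noteq> v\<close>, and length 2 would put the edge itself into \<open>F\<close>.\<close>

lemma forest_edge_separates:
  assumes "forest V E" "F \<subseteq> E" "{u, v} \<in> E" "{u, v} \<notin> F" "u \<noteq> v"
  shows "(u, v) \<notin> (edge_rel F)\<^sup>*"
proof
  assume "(u, v) \<in> (edge_rel F)\<^sup>*"
  then obtain vs where vs: "vs \<noteq> []" "distinct vs" "hd vs = u" "last vs = v"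
    "\<And>i. Suc i < length vs \<Longrightarrow> {vs ! i, vs ! Suc i} \<in> F"
    using rtrancl_distinct_path by blast
  have "length vs \<noteq> 1" using vs(3,4) assms(5) by (auto simp: length_Suc_conv)
  moreover have "length vs \<noteq> 2"
  proof
    assume l: "length vs = 2"
    then have "{vs ! 0, vs ! 1} \<in> F" using vs(5)[of 0] by simp
    moreover have "vs ! 0 = u" "vs ! 1 = v" using l vs(1,3,4) by (auto simp: hd_conv_nth last_conv_nth)
    ultimately show False using assms(4) by simp
  qed
  moreover have "length vs \<noteq> 0" using vs(1) by simp
  ultimately have "length vs \<ge> 3" by linarith
  then have "is_cycle E vs"
    using vs assms(2,3) by (auto simp: is_cycle_def insert_commute)
  then show False using assms(1) by (auto simp: forest_def)
qed

text \<open>The map from old components to the new ones containing them is onto and identifies the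
  components of \<open>u\<close> and \<open>v\<close>, so it is not injective.\<close>

lemma card_comps_insert:
  assumes "finite V" "u \<in> V" "v \<in> V" "(u, v) \<notin> (edge_rel F)\<^sup>*"
  shows "card (comps V (insert {u, v} F)) + 1 \<le> card (comps V F)"
proof -
  let ?F = "insert {u, v} F"
  let ?f = "\<lambda>A. conn V ?F `` A"
  have fin: "finite (comps V F)"
    unfolding comps_conn using assms(1) equiv_type[OF equiv_conn] by (rule finite_quotient)
  have sub: "comps V ?F \<subseteq> ?f ` comps V F"
  proof
    fix A assume "A \<in> comps V ?F"
    then obtain w where w: "w \<in> V" "A = conn V ?F `` {w}"
      unfolding comps_conn by (auto elim: quotientE)
    then have "A = ?f (conn V F `` {w})" using conn_class_image[of F ?F w V] by auto
    then show "A \<in> ?f ` comps V F" unfolding comps_conn using w(1) by (auto intro: quotientI)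
  qed
  let ?U = "conn V F `` {u}" and ?V = "conn V F `` {v}"
  have "(u, v) \<in> conn V ?F" using assms(2,3) by (auto simp: conn_def edge_rel_def)
  then have eq: "?f ?U = ?f ?V"
    using conn_class_image[of F ?F _ V] assms(2,3) equiv_class_eq[OF equiv_conn] by (metis subset_insertI)
  have "v \<in> ?V" "v \<notin> ?U" using assms by (auto simp: conn_def)
  then have ne: "?U \<noteq> ?V" by blast
  have mem: "?U \<in> comps V F" "?V \<in> comps V F"
    unfolding comps_conn using assms(2,3) by (auto intro: quotientI)
  have "\<not> inj_on ?f (comps V F)" using eq ne mem unfolding inj_on_def by blast
  then have "card (?f ` comps V F) < card (comps V F)"
    using card_image_le[OF fin, of ?f] eq_card_imp_inj_on[OF fin, of ?f] by fastforce
  then show ?thesis using card_mono[OF finite_imageI[OF fin] sub] by linarith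
qed

text \<open>The edges of \<open>E - F\<close> are added one at a time; by acyclicity each of them
  joins two different components.\<close>

lemma forest_card_comps_le:
  assumes "forest V E" "F \<subseteq> E"
  shows "card (E - F) + card (comps V E) \<le> card (comps V F)"
proof -
  have g: "graph V E" using assms(1) by (simp add: forest_def)
  have "card D + card (comps V (F \<union> D)) \<le> card (comps V F)" if "finite D" "D \<subseteq> E - F" for D
    using that
  proof (induction D rule: finite_induct)
    case (insert e D)
    obtain u v where e: "e = {u, v}" "u \<noteq> v" "u \<in> V" "v \<in> V"
      using graph_edgeE[OF g, of e] insert by blast
    have "(u, v) \<notin> (edge_rel (F \<union> D))\<^sup>*"
      by (rule forest_edge_separates[OF assms(1)]) (use insert e assms(2) in auto)
    then have "card (comps V (insert {u, v} (F \<union> D))) + 1 \<le> card (comps V (F \<union> D))"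
      using card_comps_insert e g by (simp add: graph_def)
    then show ?case using insert e by simp
  qed simp
  from this[of "E - F"] show ?thesis
    using graph_finite_edges[OF g] assms(2) by (simp add: Un_absorb1)
qed

subsection \<open>Degrees in a clustering\<close>

definition internal :: "nat set set \<Rightarrow> nat set set \<Rightarrow> nat set set" where
  "internal E P = {e \<in> E. \<exists>C\<in>P. e \<subseteq> C}"

text \<open>Connectivity is required through edges inside clusters. As clusters are disjoint, such a
  path never leaves its cluster, so this says that every cluster induces a connected
  subgraph.\<close>

definition clustering :: "nat set \<Rightarrow> nat set set \<Rightarrow> nat set set \<Rightarrow> bool" where
  "clustering V E P \<longleftrightarrow> partition_on V P \<and>
     (\<forall>C\<in>P. \<forall>u\<in>C. \<forall>v\<in>C. (u, v) \<in> (edge_rel (internal E P))\<^sup>*)"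

text \<open>The clusters that are not yet whole components. Their number measures progress.\<close>

definition active :: "nat set set \<Rightarrow> nat set set \<Rightarrow> nat set set" where
  "active E P = {C \<in> P. cdeg E C > 0}"

lemma clustering_singletons: "clustering V E ((\<lambda>v. {v}) ` V)"
  by (auto simp: clustering_def partition_on_def disjoint_def)

locale forest_clustering =
  fixes V :: "nat set" and E P :: "nat set set"
  assumes forest: "forest V E" and clustering: "clustering V E P"
begin

lemma graph: "graph V E" using forest by (simp add: forest_def)

lemma finite_V: "finite V" using graph by (simp add: graph_def)

lemma finite_E: "finite E" using graph by (rule graph_finite_edges)

lemma part: "partition_on V P" using clustering by (simp add: clustering_def)

lemma finite_P: "finite P" using finite_elements[OF finite_V part] .

lemma finite_active: "finite (active E P)" using finite_P by (simp add: active_def)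

lemma cluster_unique: "\<lbrakk>C \<in> P; D \<in> P; x \<in> C; x \<in> D\<rbrakk> \<Longrightarrow> C = D"
  using part unfolding partition_on_def disjoint_def by blast

lemma cluster_sub: "C \<in> P \<Longrightarrow> C \<subseteq> V"
  using part unfolding partition_on_def by blast

lemma cluster_ex: "x \<in> V \<Longrightarrow> \<exists>C\<in>P. x \<in> C"
  using part unfolding partition_on_def by blast

lemma cluster_nonempty: "C \<in> P \<Longrightarrow> C \<noteq> {}"
  using part unfolding partition_on_def by blast

lemma internal_connected:
  "\<lbrakk>C \<in> P; u \<in> C; v \<in> C\<rbrakk> \<Longrightarrow> (u, v) \<in> (edge_rel (internal E P))\<^sup>*"
  using clustering unfolding clustering_def by blast

lemma connected: "\<lbrakk>C \<in> P; u \<in> C; v \<in> C\<rbrakk> \<Longrightarrow> (u, v) \<in> (edge_rel E)\<^sup>*"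
  using internal_connected edge_rel_mono[of "internal E P" E] by (auto simp: internal_def)

text \<open>Each cluster lies in a single component of the internal edges, and the clusters cover
  \<open>V\<close>, so the map from clusters to these components is onto.\<close>

lemma card_comps_internal: "card (comps V (internal E P)) \<le> card P"
proof -
  let ?R = "conn V (internal E P)"
  have "comps V (internal E P) \<subseteq> (\<lambda>C. ?R `` C) ` P"
  proof
    fix A assume "A \<in> comps V (internal E P)"
    then obtain v where v: "v \<in> V" "A = ?R `` {v}"
      unfolding comps_conn by (auto elim: quotientE)
    obtain C where C: "C \<in> P" "v \<in> C" using cluster_ex[OF v(1)] by blast
    have "?R `` C = A"
      using v C internal_connected[OF C(1)] cluster_sub[OF C(1)]
      by (auto simp: conn_def intro: rtrancl_trans)
    then show "A \<in> (\<lambda>C. ?R `` C) ` P" using C by blast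
  qed
  then show ?thesis using finite_P surj_card_le by blast
qed

text \<open>No edge leaves \<open>C\<close>, so everything reachable from a vertex of
  \<open>C\<close> stays in \<open>C\<close>; connectedness gives the converse.\<close>

lemma cdeg_zero_comps:
  assumes "C \<in> P" "cdeg E C = 0"
  shows "C \<in> comps V E"
proof -
  obtain u where u: "u \<in> C" using cluster_nonempty[OF assms(1)] by blast
  have none: "card (e \<inter> C) \<noteq> 1" if "e \<in> E" for e
    using assms(2) finite_E that by (auto simp: cdeg_def)
  have "v \<in> C" if "(u, v) \<in> (edge_rel E)\<^sup>*" for v
    using that
  proof (induction rule: rtrancl_induct)
    case (step y z)
    have yz: "{y, z} \<in> E" using step(2) by (simp add: edge_rel_def)
    show ?case
    proof (rule ccontr)
      assume "z \<notin> C"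
      then have "{y, z} \<inter> C = {y}" using step(3) by auto
      then show False using none[OF yz] by simp
    qed
  qed (rule u)
  then have "C = conn V E `` {u}"
    using connected[OF assms(1) u] cluster_sub[OF assms(1)] u by (auto simp: conn_def)
  then show ?thesis
    unfolding comps_conn using u cluster_sub[OF assms(1)] by (auto intro: quotientI)
qed

text \<open>In a forest the crossing edges and the components together number at most
  \<open>card P\<close>. Inactive clusters are components, and cancelling them leaves the active
  ones.\<close>

lemma crossing_edges_le: "card (E - internal E P) \<le> card (active E P)"
proof -
  have "card (P - active E P) \<le> card (comps V E)"
  proof (rule card_mono)
    show "finite (comps V E)"
      unfolding comps_conn using finite_V equiv_type[OF equiv_conn] by (rule finite_quotient)
    show "P - active E P \<subseteq> comps V E" using cdeg_zero_comps by (auto simp: active_def)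
  qed
  moreover have "card (E - internal E P) + card (comps V E) \<le> card P"
    using forest_card_comps_le[OF forest, of "internal E P"] card_comps_internal
    by (auto simp: internal_def)
  moreover have "card P = card (active E P) + card (P - active E P)"
    using card_Diff_subset[OF finite_active, of P] card_mono[OF finite_P, of "active E P"]
    by (auto simp: active_def)
  ultimately show ?thesis by linarith
qed

text \<open>Double counting: an edge inside a cluster counts for no degree, any other edge for at
  most two.\<close>

lemma sum_cdeg_le: "(\<Sum>C\<in>P. cdeg E C) \<le> 2 * card (active E P)"
proof -
  have per: "card {C \<in> P. card (e \<inter> C) = 1} \<le> (if e \<in> internal E P then 0 else 2)" if e: "e \<in> E" for e
  proof -
    obtain u v where uv: "e = {u, v}" "u \<noteq> v" "u \<in> V" "v \<in> V" using graph_edgeE[OF graph e] .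
    show ?thesis
    proof (cases "e \<in> internal E P")
      case True
      then obtain D where D: "D \<in> P" "e \<subseteq> D" by (auto simp: internal_def)
      have "card (e \<inter> C) \<noteq> 1" if C: "C \<in> P" for C
      proof (cases "C = D")
        case True
        then show ?thesis using D uv by (simp add: Int_absorb2)
      next
        case False
        then have "e \<inter> C = {}" using cluster_unique[OF C D(1)] D(2) by blast
        then show ?thesis by simp
      qed
      then have "{C \<in> P. card (e \<inter> C) = 1} = {}" by blast
      then show ?thesis using True by (simp only: card.empty if_True order_refl)
    next
      case False
      obtain A B where AB: "A \<in> P" "u \<in> A" "B \<in> P" "v \<in> B"
        using cluster_ex uv by blast
      have "{C \<in> P. card (e \<inter> C) = 1} \<subseteq> {A, B}"
      proof
        fix C assume C: "C \<in> {C \<in> P. card (e \<inter> C) = 1}"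
        then have "e \<inter> C \<noteq> {}" by fastforce
        then show "C \<in> {A, B}" using C uv cluster_unique AB by auto
      qed
      then have "card {C \<in> P. card (e \<inter> C) = 1} \<le> card {A, B}" by (intro card_mono) auto
      also have "\<dots> \<le> 2" by (simp add: card_insert_if)
      finally show ?thesis using False by simp
    qed
  qed
  have "(\<Sum>C\<in>P. cdeg E C) = (\<Sum>e\<in>E. card {C \<in> P. card (e \<inter> C) = 1})"
  proof -
    have "(\<Sum>C\<in>P. cdeg E C) = (\<Sum>C\<in>P. \<Sum>e\<in>E. if card (e \<inter> C) = 1 then 1 else 0)"
      unfolding cdeg_def using finite_E by (simp add: sum.If_cases Int_def)
    also have "\<dots> = (\<Sum>e\<in>E. \<Sum>C\<in>P. if card (e \<inter> C) = 1 then 1 else 0)"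
      by (rule sum.swap)
    also have "\<dots> = (\<Sum>e\<in>E. card {C \<in> P. card (e \<inter> C) = 1})"
      using finite_P by (simp add: sum.If_cases Int_def)
    finally show ?thesis .
  qed
  also have "\<dots> \<le> (\<Sum>e\<in>E. if e \<in> internal E P then 0 else 2)"
    by (rule sum_mono) (rule per)
  also have "\<dots> = 2 * card (E - internal E P)"
  proof -
    have "E \<inter> - internal E P = E - internal E P" by auto
    then show ?thesis using finite_E by (simp add: sum.If_cases)
  qed
  also have "\<dots> \<le> 2 * card (active E P)" using crossing_edges_le by simp
  finally show ?thesis .
qed

section \<open>Adjacent clusters and neighbourhoods\<close>

lemma cadj_edgeE:
  assumes "C \<in> P" "D \<in> P" "cadj E C D"
  obtains x y where "x \<in> C" "y \<in> D" "{x, y} \<in> E"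
proof -
  obtain e where e: "C \<noteq> D" "e \<in> E" "e \<inter> C \<noteq> {}" "e \<inter> D \<noteq> {}"
    using assms(3) by (auto simp: cadj_def)
  obtain u v where uv: "e = {u, v}" using graph_edgeE[OF graph e(2)] by metis
  have "\<not> (u \<in> C \<and> u \<in> D)" "\<not> (v \<in> C \<and> v \<in> D)"
    using cluster_unique[OF assms(1,2)] e(1) by blast+
  then have "(u \<in> C \<and> v \<in> D) \<or> (v \<in> C \<and> u \<in> D)" using e uv by auto
  then show ?thesis using that e(2) uv by (metis insert_commute)
qed

lemma cadj_sym: "cadj E C D \<Longrightarrow> cadj E D C"
  by (auto simp: cadj_def)

text \<open>For each neighbour an edge leading to it is chosen. The choice is injective, since the
  endpoint of the edge outside \<open>C\<close> lies in only one cluster.\<close>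

lemma card_neighbours_le:
  assumes "C \<in> P"
  shows "card {D \<in> P. cadj E C D} \<le> cdeg E C"
proof -
  have "\<forall>D\<in>{D \<in> P. cadj E C D}. \<exists>e. e \<in> E \<and> card (e \<inter> C) = 1 \<and> (\<exists>x\<in>C. \<exists>y\<in>D. e = {x, y})"
  proof
    fix D assume "D \<in> {D \<in> P. cadj E C D}"
    then have D: "D \<in> P" "cadj E C D" by auto
    obtain x y where xy: "x \<in> C" "y \<in> D" "{x, y} \<in> E" using cadj_edgeE[OF assms D] .
    have "y \<notin> C" using cluster_unique[OF assms D(1)] xy D(2) by (auto simp: cadj_def)
    then have "{x, y} \<inter> C = {x}" using xy by auto
    then show "\<exists>e. e \<in> E \<and> card (e \<inter> C) = 1 \<and> (\<exists>x\<in>C. \<exists>y\<in>D. e = {x, y})"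
      using xy(1,2,3) by (metis is_singletonI is_singleton_altdef)
  qed
  then obtain f where f: "\<And>D. D \<in> P \<Longrightarrow> cadj E C D \<Longrightarrow>
      f D \<in> E \<and> card (f D \<inter> C) = 1 \<and> (\<exists>x\<in>C. \<exists>y\<in>D. f D = {x, y})"
    by (metis (no_types, lifting) mem_Collect_eq)
  show ?thesis
    unfolding cdeg_def
  proof (rule card_inj_on_le[where f = f])
    show "inj_on f {D \<in> P. cadj E C D}"
    proof (rule inj_onI)
      fix D D' assume D: "D \<in> {D \<in> P. cadj E C D}" "D' \<in> {D \<in> P. cadj E C D}" and eq: "f D = f D'"
      obtain x y where xy: "x \<in> C" "y \<in> D" "f D = {x, y}" using f D(1) by blast
      obtain x' y' where xy': "x' \<in> C" "y' \<in> D'" "f D' = {x', y'}" using f D(2) by blast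
      have "y \<notin> C" using cluster_unique[OF assms] xy D(1) by (auto simp: cadj_def)
      then have "y = y'" using eq xy xy' by (metis doubleton_eq_iff)
      then show "D = D'" using D xy xy' cluster_unique by blast
    qed
    show "f ` {D \<in> P. cadj E C D} \<subseteq> {e \<in> E. card (e \<inter> C) = 1}" using f by auto
    show "finite {e \<in> E. card (e \<inter> C) = 1}" using finite_E by simp
  qed
qed

lemma neighbour_ex:
  assumes "C \<in> P" "cdeg E C > 0"
  shows "\<exists>D\<in>P. cadj E C D"
proof -
  have "{e \<in> E. card (e \<inter> C) = 1} \<noteq> {}" using assms(2) unfolding cdeg_def by (metis card.empty less_irrefl)
  then obtain e where e: "e \<in> E" "card (e \<inter> C) = 1" by blast
  obtain u v where uv: "e = {u, v}" "u \<noteq> v" "u \<in> V" "v \<in> V" using graph_edgeE[OF graph e(1)] .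
  have "\<not> e \<subseteq> C" using e(2) uv by (auto simp: Int_absorb2)
  then obtain y where y: "y \<in> e" "y \<notin> C" by blast
  obtain D where D: "D \<in> P" "y \<in> D" using cluster_ex y uv by blast
  have "e \<inter> C \<noteq> {}" using e(2) by fastforce
  then have "cadj E C D" unfolding cadj_def using D y e(1) by blast
  then show ?thesis using D by blast
qed

lemma cadj_cdeg_pos:
  assumes "C \<in> P" "D \<in> P" "cadj E C D"
  shows "cdeg E C > 0"
proof -
  have "{D \<in> P. cadj E C D} \<noteq> {}" using assms by blast
  then have "card {D \<in> P. cadj E C D} > 0" using finite_P by (simp add: card_gt_0_iff)
  then show ?thesis using card_neighbours_le[OF assms(1)] by linarith
qed

text \<open>The neighbour sets of the members of \<open>A\<close> cover \<open>B\<close>. This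
  charges ungrouped clusters to the degrees of the clusters they touch.\<close>

lemma card_neighbourhood_le:
  assumes "A \<subseteq> P" "\<And>C. C \<in> B \<Longrightarrow> C \<in> P \<and> (\<exists>D\<in>A. cadj E C D)"
  shows "card B \<le> (\<Sum>D\<in>A. cdeg E D)"
proof -
  have finA: "finite A" using assms(1) finite_P finite_subset by blast
  have "B \<subseteq> (\<Union>D\<in>A. {C \<in> P. cadj E D C})" using assms(2) cadj_sym by blast
  then have "card B \<le> card (\<Union>D\<in>A. {C \<in> P. cadj E D C})"
    using finA finite_P by (intro card_mono) auto
  also have "\<dots> \<le> (\<Sum>D\<in>A. card {C \<in> P. cadj E D C})" using finA by (rule card_UN_le)
  also have "\<dots> \<le> (\<Sum>D\<in>A. cdeg E D)" using card_neighbours_le assms(1) by (intro sum_mono) auto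
  finally show ?thesis .
qed

text \<open>If every degree were 0, all clusters would be components, and as they cover
  \<open>V\<close> no component would be missing. Hence every level before the last has an active
  cluster.\<close>

lemma active_nonempty:
  assumes "P \<noteq> comps V E"
  shows "active E P \<noteq> {}"
proof
  assume "active E P = {}"
  then have sub: "P \<subseteq> comps V E" using cdeg_zero_comps by (auto simp: active_def)
  have "comps V E \<subseteq> P"
  proof
    fix A assume A: "A \<in> comps V E"
    then obtain v where v: "v \<in> V" "v \<in> A"
      unfolding comps_conn by (metis equiv_conn equiv_class_self quotientE)
    obtain C where C: "C \<in> P" "v \<in> C" using cluster_ex[OF v(1)] by blast
    have "C = A"
      using quotient_disj[OF equiv_conn, of C V E A] A C v sub unfolding comps_conn by blast
    then show "A \<in> P" using C by simp
  qed
  then show False using assms sub by blast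
qed

end

subsection \<open>One contraction step\<close>

locale ufo_contraction = forest_clustering +
  fixes Gs :: "nat set set set" and P' :: "nat set set"
  assumes step: "ufo_step E P Gs P'"
begin

lemma groups_sub: "G \<in> Gs \<Longrightarrow> G \<subseteq> P"
  using step by (auto simp: ufo_step_def allowed_group_def)

lemma group_unique: "\<lbrakk>G \<in> Gs; G' \<in> Gs; C \<in> G; C \<in> G'\<rbrakk> \<Longrightarrow> G = G'"
  using step unfolding ufo_step_def by blast

lemma P'_eq: "P' = (Union ` Gs) \<union> (P - \<Union>Gs)"
  using step by (simp add: ufo_step_def)

lemma finite_Gs: "finite Gs"
proof -
  have "Gs \<subseteq> Pow P" using groups_sub by blast
  then show ?thesis using finite_P finite_subset by blast
qed

lemma finite_group: "G \<in> Gs \<Longrightarrow> finite G"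
  using groups_sub finite_P finite_subset by blast

text \<open>Unifies the two kinds of merge: every group is a star, a pair being a star around one of
  its members.\<close>

lemma group_hub:
  assumes "G \<in> Gs"
  shows "\<exists>H\<in>G. G \<noteq> {H} \<and> (\<forall>D\<in>G - {H}. cadj E H D)"
proof -
  have "allowed_group E P G" using step assms by (simp add: ufo_step_def)
  then show ?thesis unfolding allowed_group_def
  proof (elim conjE disjE exE bexE)
    fix C D assume "G = {C, D}" "cadj E C D"
    then show ?thesis by (intro bexI[of _ C]) (auto simp: cadj_def)
  next
    fix H assume "H \<in> G" "G - {H} \<noteq> {}" "\<forall>D\<in>G - {H}. cdeg E D = 1 \<and> cadj E H D"
    then show ?thesis by (intro bexI[of _ H]) auto
  qed
qed

text \<open>Within a star every member has a neighbour, hence positive degree.\<close>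

lemma groups_active: "\<Union>Gs \<subseteq> active E P"
proof
  fix C assume "C \<in> \<Union>Gs"
  then obtain G where G: "G \<in> Gs" "C \<in> G" by blast
  obtain H where H: "H \<in> G" "G \<noteq> {H}" "\<And>D. D \<in> G - {H} \<Longrightarrow> cadj E H D"
    using group_hub[OF G(1)] by blast
  have "\<exists>D\<in>G. cadj E C D"
  proof (cases "C = H")
    case True
    then show ?thesis using H by blast
  next
    case False
    then show ?thesis using H G cadj_sym by blast
  qed
  then show "C \<in> active E P"
    using G groups_sub cadj_cdeg_pos unfolding active_def by blast
qed

section \<open>The merged clusters form a clustering again\<close>

lemma partition_step: "partition_on V P'"
proof (rule partition_onI)
  show "\<Union>P' = V"
    using part groups_sub unfolding P'_eq partition_on_def by blast
  show "disjnt A B" if AB: "A \<in> P'" "B \<in> P'" "A \<noteq> B" for A B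
  proof (rule ccontr)
    assume "\<not> disjnt A B"
    then obtain x where x: "x \<in> A" "x \<in> B" by (auto simp: disjnt_def)
    \<comment> \<open>The old cluster containing \<open>x\<close> determines the new one: itself if
      ungrouped, otherwise the union of its only group.\<close>
    have aux: "\<exists>C. C \<in> P \<and> x \<in> C \<and> ((C \<notin> \<Union>Gs \<and> A = C) \<or> (\<exists>G\<in>Gs. C \<in> G \<and> A = \<Union>G))"
      if "A \<in> P'" "x \<in> A" for A
      using that groups_sub unfolding P'_eq by blast
    obtain C where C: "C \<in> P" "x \<in> C" "(C \<notin> \<Union>Gs \<and> A = C) \<or> (\<exists>G\<in>Gs. C \<in> G \<and> A = \<Union>G)"
      using aux[OF AB(1) x(1)] by blast
    obtain D where D: "D \<in> P" "x \<in> D" "(D \<notin> \<Union>Gs \<and> B = D) \<or> (\<exists>G\<in>Gs. D \<in> G \<and> B = \<Union>G)"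
      using aux[OF AB(2) x(2)] by blast
    have "C = D" using cluster_unique C D by blast
    then show False using C(3) D(3) AB(3) group_unique by blast
  qed
  show "{} \<notin> P'"
  proof
    assume "{} \<in> P'"
    then obtain G where "G \<in> Gs" "\<Union>G = {}"
      unfolding P'_eq using cluster_nonempty by blast
    then show False using group_hub[of G] groups_sub[of G] cluster_nonempty by blast
  qed
qed

text \<open>Internal edges stay internal, and the edges between a hub and its partners become
  internal. So every vertex of a merged cluster is reachable from one fixed vertex \<open>w\<close>
  of the hub.\<close>

lemma clustering_step: "clustering V E P'"
  unfolding clustering_def
proof (intro conjI partition_step ballI)
  let ?R = "(edge_rel (internal E P'))\<^sup>*"
  fix A u v assume A: "A \<in> P'" "u \<in> A" "v \<in> A"
  have "internal E P \<subseteq> internal E P'"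
  proof
    fix e assume "e \<in> internal E P"
    then obtain C where C: "e \<in> E" "C \<in> P" "e \<subseteq> C" by (auto simp: internal_def)
    have "\<exists>B\<in>P'. C \<subseteq> B" using C(2) unfolding P'_eq by blast
    then show "e \<in> internal E P'" using C unfolding internal_def by blast
  qed
  then have old: "(a, b) \<in> ?R" if "C \<in> P" "a \<in> C" "b \<in> C" for C a b
    using internal_connected[OF that] edge_rel_mono[of "internal E P" "internal E P'"] by (meson subsetD)
  consider "A \<in> P" | G where "G \<in> Gs" "A = \<Union>G" using A(1) unfolding P'_eq by blast
  then show "(u, v) \<in> ?R"
  proof cases
    case 1
    then show ?thesis using A(2,3) by (rule old)
  next
    case 2
    obtain H where H: "H \<in> G" "\<And>D. D \<in> G - {H} \<Longrightarrow> cadj E H D"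
      using group_hub[OF 2(1)] by blast
    have HP: "H \<in> P" using H(1) groups_sub 2(1) by blast
    obtain w where w: "w \<in> H" using cluster_nonempty[OF HP] by blast
    have hub: "(w, a) \<in> ?R" if a: "a \<in> A" for a
    proof -
      obtain D where D: "D \<in> G" "a \<in> D" using a 2 by blast
      have DP: "D \<in> P" using D groups_sub 2(1) by blast
      show ?thesis
      proof (cases "D = H")
        case True
        then show ?thesis using D by (intro old[OF HP w]) simp
      next
        case False
        then obtain x y where xy: "x \<in> H" "y \<in> D" "{x, y} \<in> E"
          using cadj_edgeE[OF HP DP] H(2) D(1) by blast
        have "{x, y} \<subseteq> A" using xy D(1) H(1) 2(2) by blast
        then have "{x, y} \<in> internal E P'" using xy A(1) by (auto simp: internal_def)
        then have "(x, y) \<in> ?R" by (auto simp: edge_rel_def)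
        then show ?thesis
          using old[OF HP w xy(1)] old[OF DP xy(2) D(2)] by (meson rtrancl_trans)
      qed
    qed
    show ?thesis using hub[OF A(2)] hub[OF A(3)] edge_rel_rtrancl_sym by (meson rtrancl_trans)
  qed
qed

section \<open>How many active clusters a step removes\<close>

lemma card_Union_groups: "card (\<Union>Gs) = (\<Sum>G\<in>Gs. card G)"
  by (rule card_Union_disjoint) (use group_unique finite_group in \<open>auto simp: pairwise_def disjnt_def\<close>)

text \<open>An active new cluster is a merged group or an ungrouped active old cluster, whose degree
  does not change. The additive form avoids truncated subtraction.\<close>

lemma card_active_step: "card (active E P') + card (\<Union>Gs) \<le> card Gs + card (active E P)"
proof -
  have "active E P' \<subseteq> Union ` Gs \<union> (active E P - \<Union>Gs)"
    unfolding P'_eq active_def by blast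
  then have "card (active E P') \<le> card (Union ` Gs \<union> (active E P - \<Union>Gs))"
    using finite_Gs finite_active by (intro card_mono) auto
  also have "\<dots> \<le> card (Union ` Gs) + card (active E P - \<Union>Gs)" by (rule card_Un_le)
  also have "\<dots> \<le> card Gs + (card (active E P) - card (\<Union>Gs))"
    using card_image_le[OF finite_Gs, of Union] card_Diff_subset[OF _ groups_active]
      finite_subset[OF groups_active finite_active] by simp
  finally show ?thesis using card_mono[OF finite_active groups_active] by linarith
qed

abbreviation small :: "nat set set" where "small \<equiv> {C \<in> P. cdeg E C \<in> {1, 2}}"

text \<open>Merging \<open>G\<close> removes \<open>card G - 1\<close> clusters, and this is at
  least half the number of its small members: a pair loses one cluster for at most two small ones,
  and the hub of a high-degree group is not small.\<close>

lemma card_small_group: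
  assumes "G \<in> Gs"
  shows "card (G \<inter> small) + 2 \<le> 2 * card G"
proof -
  have fin: "finite G" using finite_group[OF assms] .
  have "allowed_group E P G" using step assms by (simp add: ufo_step_def)
  then show ?thesis unfolding allowed_group_def
  proof (elim conjE disjE exE bexE)
    fix C D assume "G = {C, D}" "cadj E C D"
    then have "card G = 2" by (auto simp: cadj_def)
    then show ?thesis using card_mono[OF fin, of "G \<inter> small"] by simp
  next
    fix H assume H: "H \<in> G" "cdeg E H \<ge> 3" "G - {H} \<noteq> {}"
    then have "card (G \<inter> small) \<le> card (G - {H})" using fin by (intro card_mono) auto
    moreover have "card (G - {H}) > 0" using H(3) fin by (metis card_gt_0_iff finite_Diff)
    moreover have "card (G - {H}) = card G - 1" using H by simp
    ultimately show ?thesis by linarith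
  qed
qed

lemma card_grouped_small: "card (small \<inter> \<Union>Gs) + 2 * card Gs \<le> 2 * card (\<Union>Gs)"
proof -
  have "small \<inter> \<Union>Gs = (\<Union>G\<in>Gs. G \<inter> small)" by blast
  then have "card (small \<inter> \<Union>Gs) \<le> (\<Sum>G\<in>Gs. card (G \<inter> small))"
    using card_UN_le[OF finite_Gs, of "\<lambda>G. G \<inter> small"] by simp
  moreover have "(\<Sum>G\<in>Gs. card (G \<inter> small) + 2) \<le> (\<Sum>G\<in>Gs. 2 * card G)"
    by (rule sum_mono) (rule card_small_group)
  ultimately show ?thesis
    unfolding card_Union_groups sum.distrib sum_distrib_left[symmetric] sum_constant of_nat_id
    by linarith
qed

text \<open>Leaves \<open>L\<close>, degree-2 clusters \<open>M\<close> and high-degree clusters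
  \<open>H\<close> are all bounded by the grouped small clusters \<open>S\<close>: the degree sum
  bounds \<open>H\<close> by \<open>L\<close>, and maximality bounds \<open>L\<close> and then all
  small clusters by neighbourhoods of \<open>S\<close> and \<open>H\<close>.\<close>

lemma card_active_le_grouped: "card (active E P) \<le> 15 * card (small \<inter> \<Union>Gs)"
proof -
  define L where "L = {C \<in> P. cdeg E C = 1}"
  define M where "M = {C \<in> P. cdeg E C = 2}"
  define H where "H = {C \<in> P. cdeg E C \<ge> 3}"
  define S where "S = small \<inter> \<Union>Gs"
  have fin: "finite L" "finite M" "finite H" "finite S"
    using finite_P by (auto simp: L_def M_def H_def S_def)
  have small: "small = L \<union> M" by (auto simp: L_def M_def)
  have act: "active E P = L \<union> M \<union> H" by (auto simp: active_def L_def M_def H_def)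
  have disj: "L \<inter> M = {}" "(L \<union> M) \<inter> H = {}" by (auto simp: L_def M_def H_def)
  have card_act: "card (active E P) = card L + card M + card H"
    unfolding act using fin disj by (simp add: card_Un_disjoint)
  have "(\<Sum>C\<in>L \<union> M \<union> H. cdeg E C) \<le> (\<Sum>C\<in>P. cdeg E C)"
    using finite_P by (intro sum_mono2) (auto simp: L_def M_def H_def)
  then have "(\<Sum>C\<in>L \<union> M \<union> H. cdeg E C) \<le> 2 * (card L + card M + card H)"
    using sum_cdeg_le unfolding card_act by (rule order_trans)
  moreover have "(\<Sum>C\<in>L \<union> M \<union> H. cdeg E C) = (\<Sum>C\<in>L. cdeg E C) + (\<Sum>C\<in>M. cdeg E C) + (\<Sum>C\<in>H. cdeg E C)"
    using fin disj by (simp add: sum.union_disjoint)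
  moreover have "(\<Sum>C\<in>L. cdeg E C) = card L" "(\<Sum>C\<in>M. cdeg E C) = 2 * card M"
    by (simp_all add: L_def M_def)
  moreover have "3 * card H \<le> (\<Sum>C\<in>H. cdeg E C)"
    using sum_bounded_below[of H 3 "cdeg E"] by (simp add: H_def mult.commute)
  \<comment> \<open>Writing d for the degree sum over \<open>H\<close>, the bounds give d \<le> |L|
    + 2|H|. With 3|H| \<le> d this yields |H| \<le> |L|, and then d \<le> 3|L|.\<close>
  ultimately have degH: "(\<Sum>C\<in>H. cdeg E C) \<le> 3 * card L" and HL: "card H \<le> card L"
    by presburger+
  have degS: "(\<Sum>C\<in>S. cdeg E C) \<le> 2 * card S"
  proof -
    have "\<And>C. C \<in> S \<Longrightarrow> cdeg E C \<le> 2" by (auto simp: S_def)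
    then show ?thesis using sum_bounded_above[of S "cdeg E" 2] by (simp add: mult.commute)
  qed
  \<comment> \<open>Any neighbour \<open>D\<close> of \<open>C\<close> decides the case. If
    \<open>D\<close> has high degree, a leaf \<open>C\<close> would have been grouped with it, so
    \<open>C\<close> has degree 2; if \<open>D\<close> is small, maximality of the matching makes it
    grouped.\<close>
  have cases: "(\<exists>D\<in>S. cadj E C D) \<or> (cdeg E C = 2 \<and> (\<exists>D\<in>H. cadj E C D))"
    if C: "C \<in> small - S" for C
  proof -
    have CP: "C \<in> P" "cdeg E C \<in> {1, 2}" "C \<notin> \<Union>Gs" using C by (auto simp: S_def)
    then have "cdeg E C > 0" by auto
    then obtain D where D: "D \<in> P" "cadj E C D" using neighbour_ex[OF CP(1)] by blast
    have D0: "cdeg E D > 0" using cadj_cdeg_pos[OF D(1) CP(1)] cadj_sym D(2) by blast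
    show ?thesis
    proof (cases "cdeg E D \<ge> 3")
      case True
      have "cdeg E C \<noteq> 1"
        using step CP D True cadj_sym[OF D(2)] unfolding ufo_step_def by blast
      then show ?thesis using CP(2) D True by (auto simp: H_def)
    next
      case False
      then have "cdeg E D \<in> {1, 2}" using D0 by auto
      moreover from this have "D \<in> \<Union>Gs"
        using step CP D unfolding ufo_step_def by blast
      ultimately show ?thesis using D by (auto simp: S_def)
    qed
  qed
  have SP: "S \<subseteq> P" and HP: "H \<subseteq> P" by (auto simp: S_def H_def)
  \<comment> \<open>An ungrouped leaf falls under the first alternative of \<open>cases\<close>, so
    it is charged to \<open>S\<close> alone.\<close>
  have "card (L - S) \<le> (\<Sum>C\<in>S. cdeg E C)"
  proof (rule card_neighbourhood_le[OF SP])
    fix C assume "C \<in> L - S"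
    then show "C \<in> P \<and> (\<exists>D\<in>S. cadj E C D)" using cases[of C] by (auto simp: L_def)
  qed
  moreover have "card L \<le> card (L - S) + card S"
    using card_mono[of "(L - S) \<union> S" L] card_Un_le[of "L - S" S] fin by auto
  ultimately have LS: "card L \<le> 3 * card S" using degS by linarith
  have "card (small - S) \<le> (\<Sum>C\<in>S \<union> H. cdeg E C)"
  proof (rule card_neighbourhood_le)
    show "S \<union> H \<subseteq> P" using SP HP by blast
    fix C assume "C \<in> small - S"
    then show "C \<in> P \<and> (\<exists>D\<in>S \<union> H. cadj E C D)" using cases[of C] by blast
  qed
  also have "\<dots> \<le> 2 * card S + 3 * card L"
  proof -
    have "S \<inter> H = {}" by (auto simp: S_def H_def)
    then show ?thesis using degS degH fin by (simp add: sum.union_disjoint)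
  qed
  finally have "card (small - S) \<le> 2 * card S + 3 * card L" .
  moreover have "card small = card L + card M"
    unfolding small using fin disj by (simp add: card_Un_disjoint)
  moreover have "card small \<le> card (small - S) + card S"
    using card_mono[of "(small - S) \<union> S" small] card_Un_le[of "small - S" S] fin finite_P by auto
  \<comment> \<open>With |L| \<le> 3|S| there are at most 2|S| + 9|S| ungrouped small clusters;
    adding |S| grouped ones and |H| \<le> 3|S| gives the factor 15.\<close>
  ultimately show ?thesis using card_act HL LS unfolding S_def by linarith
qed

text \<open>The loss is at least half of the grouped small clusters, which are at least 1/15 of the
  active ones; 30 clears the denominators.\<close>

lemma active_drop: "card (active E P) + 30 * card (active E P') \<le> 30 * card (active E P)"
  using card_active_step card_grouped_small card_active_le_grouped by linarith

text \<open>New clusters are unions of groups, and there are no more groups than grouped clusters,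
  all of which are active.\<close>

lemma card_new_clusters: "card (P' - P) \<le> card (active E P)"
proof -
  have "P' - P \<subseteq> Union ` Gs" unfolding P'_eq by blast
  then have "card (P' - P) \<le> card Gs" using finite_Gs surj_card_le by blast
  also have "\<dots> \<le> card (\<Union>Gs)" using card_grouped_small by linarith
  also have "\<dots> \<le> card (active E P)" using card_mono[OF finite_active groups_active] .
  finally show ?thesis .
qed

end

subsection \<open>Summing over the levels\<close>

locale ufo_tree =
  fixes V :: "nat set" and E :: "nat set set" and P :: "nat \<Rightarrow> nat set set" and h :: nat
  assumes ufo: "is_ufo V E P h"
begin

abbreviation m :: "nat \<Rightarrow> nat" where "m i \<equiv> card (active E (P i))"

lemma forest: "forest V E" and P_0: "P 0 = (\<lambda>v. {v}) ` V"
  and step_ex: "i < h \<Longrightarrow> \<exists>Gs. ufo_step E (P i) Gs (P (Suc i))"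
  and not_done: "i < h \<Longrightarrow> P i \<noteq> comps V E"
  using ufo by (auto simp: is_ufo_def)

lemma level: "i \<le> h \<Longrightarrow> forest_clustering V E (P i)"
proof (induction i)
  case 0
  show ?case using forest clustering_singletons by (simp add: forest_clustering_def P_0)
next
  case (Suc i)
  then obtain Gs where "ufo_step E (P i) Gs (P (Suc i))" using step_ex[of i] by auto
  then interpret ufo_contraction V E "P i" Gs "P (Suc i)"
    using Suc by (simp add: ufo_contraction_def ufo_contraction_axioms_def)
  show ?case using forest clustering_step by (simp add: forest_clustering_def)
qed

lemma contraction: "i < h \<Longrightarrow> \<exists>Gs. ufo_contraction V E (P i) Gs (P (Suc i))"
  using level[of i] step_ex[of i] by (auto simp: ufo_contraction_def ufo_contraction_axioms_def)

lemma m_drop: "i < h \<Longrightarrow> m i + 30 * m (Suc i) \<le> 30 * m i"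
  using contraction ufo_contraction.active_drop by blast

lemma card_P_0: "card (P 0) = card V"
  unfolding P_0 by (rule card_image) auto

lemma m_0: "m 0 \<le> card V"
  using card_mono[OF forest_clustering.finite_P[OF level[of 0]], of "active E (P 0)"] card_P_0
  by (auto simp: active_def)

text \<open>Telescoping: each \<open>m i\<close> is at most 30 times the drop from
  \<open>m i\<close> to \<open>m (Suc i)\<close>.\<close>

lemma sum_m: "(\<Sum>i\<le>h. m i) \<le> 30 * card V"
proof -
  have "(\<Sum>i<k. m i) + 30 * m k \<le> 30 * m 0" if "k \<le> h" for k
    using that
  proof (induction k)
    case (Suc k)
    then show ?case using m_drop[of k] by simp
  qed simp
  \<comment> \<open>The remaining term \<open>30 * m h\<close> pays for the summand of the last
    level.\<close>
  from this[of h] have "(\<Sum>i\<le>h. m i) \<le> 30 * m 0"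
    unfolding lessThan_Suc_atMost[symmetric] by simp
  then show ?thesis using m_0 by linarith
qed

text \<open>The level before the last still has an active cluster, while \<open>m\<close> decays
  geometrically; this bounds \<open>k = h - 1\<close> by the logarithm of \<open>card V\<close> to
  base 30/29.\<close>

lemma height: "real h \<le> (1 + 1 / log 2 (30 / 29)) * log 2 (real (card V) + 1)"
proof (cases h)
  case 0
  then show ?thesis by simp
next
  case (Suc k)
  have "30 ^ j * m j \<le> 29 ^ j * card V" if "j \<le> h" for j
    using that
  proof (induction j)
    case (Suc j)
    have "30 ^ Suc j * m (Suc j) \<le> 30 ^ j * (29 * m j)"
      using m_drop[of j] Suc(2) by simp
    also have "\<dots> \<le> 29 ^ Suc j * card V" using Suc by simp
    finally show ?case .
  qed (simp add: m_0)
  from this[of k] have le: "30 ^ k * m k \<le> 29 ^ k * card V" using Suc by simp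
  have "active E (P k) \<noteq> {}"
    using forest_clustering.active_nonempty[OF level not_done, of k] Suc by simp
  then have "m k \<ge> 1"
    using forest_clustering.finite_active[OF level[of k]] Suc by (simp add: Suc_le_eq card_gt_0_iff)
  then have "(30::nat) ^ k \<le> 30 ^ k * m k" by simp
  then have "(30::nat) ^ k \<le> 29 ^ k * card V" using le by (rule le_trans)
  then have "real (30 ^ k) \<le> real (29 ^ k * card V)" by (simp only: of_nat_le_iff)
  then have pow: "(30 / 29 :: real) ^ k \<le> real (card V)"
    by (simp add: power_divide field_simps)
  moreover have "(30 / 29 :: real) ^ k \<ge> 1" by (rule one_le_power) simp
  ultimately have n1: "real (card V) \<ge> 1" by linarith
  have pos: "log 2 (30 / 29 :: real) > 0" by simp
  have "real k * log 2 (30 / 29) = log 2 ((30 / 29) ^ k)" by (simp add: log_nat_power)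
  also have "\<dots> \<le> log 2 (real (card V) + 1)" using pow by (subst log_le_cancel_iff) auto
  finally have "real k \<le> log 2 (real (card V) + 1) / log 2 (30 / 29)"
    using pos by (simp add: pos_le_divide_eq)
  \<comment> \<open>The summand 1 in the constant pays for the step from \<open>k\<close> to
    \<open>h = Suc k\<close>.\<close>
  moreover have "1 \<le> log 2 (real (card V) + 1)" using n1 by (simp add: le_log_iff)
  ultimately have "real k + 1 \<le> log 2 (real (card V) + 1) + log 2 (real (card V) + 1) / log 2 (30 / 29)"
    by linarith
  then show ?thesis using Suc by (simp add: distrib_right)
qed

section \<open>Counting nodes and pointers\<close>

definition level_nodes :: "nat \<Rightarrow> nat set set" where
  "level_nodes i = {C \<in> P i. i = 0 \<or> C \<notin> P (i - 1) \<or> C \<notin> comps V E}"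

lemma ufo_nodes_eq: "ufo_nodes V E P h = Sigma {..h} level_nodes"
  by (auto simp: ufo_nodes_def level_nodes_def)

lemma finite_P: "i \<le> h \<Longrightarrow> finite (P i)"
  using forest_clustering.finite_P[OF level] .

lemma finite_level_nodes: "i \<le> h \<Longrightarrow> finite (level_nodes i)"
  using finite_P by (simp add: level_nodes_def)

lemma finite_nodes: "finite (ufo_nodes V E P h)"
  unfolding ufo_nodes_eq using finite_level_nodes by auto

text \<open>A node above level 0 is either newly merged or not a whole component, hence active at
  its level.\<close>

lemma card_level_nodes:
  assumes "i < h"
  shows "card (level_nodes (Suc i)) \<le> m i + m (Suc i)"
proof -
  obtain Gs where "ufo_contraction V E (P i) Gs (P (Suc i))" using contraction[OF assms] by blast
  then have new: "card (P (Suc i) - P i) \<le> m i" by (rule ufo_contraction.card_new_clusters)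
  have lv: "forest_clustering V E (P (Suc i))" using level assms by simp
  have fin: "finite (P (Suc i))" using finite_P assms by simp
  have "level_nodes (Suc i) \<subseteq> (P (Suc i) - P i) \<union> active E (P (Suc i))"
    using forest_clustering.cdeg_zero_comps[OF lv] by (auto simp: level_nodes_def active_def)
  then have "card (level_nodes (Suc i)) \<le> card ((P (Suc i) - P i) \<union> active E (P (Suc i)))"
    using fin by (intro card_mono) (auto simp: active_def)
  then show ?thesis using card_Un_le[of "P (Suc i) - P i" "active E (P (Suc i))"] new by linarith
qed

text \<open>Level 0 has \<open>card V\<close> nodes; above it each \<open>m i\<close> is charged at
  most twice, by levels \<open>i\<close> and \<open>Suc i\<close>. Hence 61 = 1 + 2 * 30.\<close>

lemma card_nodes: "card (ufo_nodes V E P h) \<le> 61 * card V"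
proof -
  have "card (ufo_nodes V E P h) = (\<Sum>i\<le>h. card (level_nodes i))"
    unfolding ufo_nodes_eq using finite_level_nodes by (intro card_SigmaI) auto
  also have "\<dots> = card (level_nodes 0) + (\<Sum>i<h. card (level_nodes (Suc i)))"
    by (rule sum.atMost_shift)
  also have "card (level_nodes 0) = card V" using card_P_0 by (simp add: level_nodes_def)
  also have "(\<Sum>i<h. card (level_nodes (Suc i))) \<le> (\<Sum>i<h. m i + m (Suc i))"
    using card_level_nodes by (intro sum_mono) auto
  also have "\<dots> \<le> 2 * (\<Sum>i\<le>h. m i)"
  proof -
    have "(\<Sum>i<h. m i) \<le> (\<Sum>i\<le>h. m i)" by (intro sum_mono2) auto
    moreover have "(\<Sum>i<h. m (Suc i)) \<le> (\<Sum>i\<le>h. m i)" by (subst sum.atMost_shift) simp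
    ultimately show ?thesis by (simp add: sum.distrib)
  qed
  finally show ?thesis using sum_m by linarith
qed

text \<open>A nonempty cluster lies in only one cluster of the next level, so child sets of
  different nodes are disjoint subsets of the nodes.\<close>

lemma sum_children: "(\<Sum>x\<in>ufo_nodes V E P h. card (ufo_children V E P h x)) \<le> card (ufo_nodes V E P h)"
proof -
  let ?N = "ufo_nodes V E P h" and ?ch = "ufo_children V E P h"
  have sub: "?ch x \<subseteq> ?N" for x by (auto simp: ufo_children_def)
  have disj: "?ch x \<inter> ?ch y = {}" if xy: "x \<in> ?N" "y \<in> ?N" "x \<noteq> y" for x y
  proof (rule ccontr)
    assume "?ch x \<inter> ?ch y \<noteq> {}"
    then obtain j D where D: "(j, D) \<in> ?N" "Suc j = fst x" "Suc j = fst y" "D \<subseteq> snd x" "D \<subseteq> snd y"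
      by (auto simp: ufo_children_def)
    have P: "D \<in> P j" "snd x \<in> P (Suc j)" "snd y \<in> P (Suc j)" "Suc j \<le> h"
      using D xy by (auto simp: ufo_nodes_def)
    have "D \<noteq> {}" using forest_clustering.cluster_nonempty[OF level[of j]] P(1,4) by simp
    then have "snd x = snd y"
      using forest_clustering.cluster_unique[OF level[OF P(4)] P(2,3)] D(4,5) by blast
    then show False using D xy(3) by (metis prod.expand)
  qed
  have "(\<Sum>x\<in>?N. card (?ch x)) = card (\<Union>x\<in>?N. ?ch x)"
    using finite_nodes sub disj finite_subset by (intro card_UN_disjoint[symmetric]) blast+
  also have "\<dots> \<le> card ?N" using finite_nodes sub by (intro card_mono) auto
  finally show ?thesis .
qed

lemma sum_adjacency:
  "(\<Sum>x\<in>ufo_nodes V E P h. card {D \<in> P (fst x). cadj E (snd x) D}) \<le> 60 * card V"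
proof -
  let ?d = "\<lambda>x. card {D \<in> P (fst x). cadj E (snd x) D}"
  \<comment> \<open>The sum is enlarged to all clusters of each level, so that the degree sum of a
    whole level bounds it by \<open>2 * m i\<close>.\<close>
  have "(\<Sum>x\<in>ufo_nodes V E P h. ?d x) \<le> (\<Sum>x\<in>Sigma {..h} P. ?d x)"
    using finite_P by (intro sum_mono2) (auto simp: ufo_nodes_def)
  also have "\<dots> = (\<Sum>i\<le>h. \<Sum>C\<in>P i. card {D \<in> P i. cadj E C D})"
    using finite_P by (subst sum.Sigma) (auto simp: case_prod_unfold)
  also have "\<dots> \<le> (\<Sum>i\<le>h. 2 * m i)"
  proof (rule sum_mono)
    fix i assume "i \<in> {..h}"
    then interpret forest_clustering V E "P i" using level by simp
    have "(\<Sum>C\<in>P i. card {D \<in> P i. cadj E C D}) \<le> (\<Sum>C\<in>P i. cdeg E C)"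
      by (rule sum_mono) (rule card_neighbours_le)
    then show "(\<Sum>C\<in>P i. card {D \<in> P i. cadj E C D}) \<le> 2 * m i"
      using sum_cdeg_le by linarith
  qed
  also have "\<dots> = 2 * (\<Sum>i\<le>h. m i)" by (simp add: sum_distrib_left)
  finally show ?thesis using sum_m by linarith
qed

text \<open>182 = 61 + 61 + 60, for parent pointers, children pointers and adjacency lists.\<close>

lemma space: "ufo_space V E P h \<le> 182 * card V"
proof -
  have "ufo_space V E P h = card (ufo_nodes V E P h)
      + (\<Sum>x\<in>ufo_nodes V E P h. card (ufo_children V E P h x))
      + (\<Sum>x\<in>ufo_nodes V E P h. card {D \<in> P (fst x). cadj E (snd x) D})"
    unfolding ufo_space_def sum.distrib by simp
  then show ?thesis using sum_children sum_adjacency card_nodes by linarith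
qed

end

theorem theorem4p1:
  shows "\<exists>c::real. c > 0 \<and>
    (\<forall>(V::nat set) E P h. is_ufo V E P h \<longrightarrow>
        real h \<le> c * log 2 (real (card V) + 1) \<and>
        real (card (ufo_nodes V E P h)) \<le> c * real (card V) \<and>
        real (ufo_space V E P h) \<le> c * real (card V))"
proof -
  define a :: real where "a = 1 / log 2 (30 / 29)"
  have a: "a > 0" unfolding a_def by simp
  show ?thesis
  \<comment> \<open>One constant for all three bounds: it exceeds the height constant
    \<open>1 + a\<close> and the factors 61 and 182.\<close>
  proof (rule exI[of _ "182 + a"], intro conjI allI impI)
    fix V :: "nat set" and E P h assume "is_ufo V E P h"
    then interpret ufo_tree V E P h by (rule ufo_tree.intro)
    have "real h \<le> (1 + a) * log 2 (real (card V) + 1)" using height by (simp add: a_def)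
    also have "\<dots> \<le> (182 + a) * log 2 (real (card V) + 1)"
      by (rule mult_right_mono) (simp_all add: zero_le_log_cancel_iff)
    finally show "real h \<le> (182 + a) * log 2 (real (card V) + 1)" .
    have mono: "real (182 * card V) \<le> (182 + a) * real (card V)"
      using a by (simp add: distrib_right)
    have "card (ufo_nodes V E P h) \<le> 182 * card V" using card_nodes by linarith
    then show "real (card (ufo_nodes V E P h)) \<le> (182 + a) * real (card V)"
      using mono by (meson of_nat_le_iff order_trans)
    show "real (ufo_space V E P h) \<le> (182 + a) * real (card V)"
      using mono space by (meson of_nat_le_iff order_trans)
  qed (use a in simp)
qed

end
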